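(* Let $n\ge 1$ and fix a partition of $n\times n$ complex matrices into $2\times 2$ block form with square diagonal blocks. The following are true: (1) Let $A\in M_n(\mathbb{C})$ be a block $2$ by $2$ matrix $A=\begin{bmatrix} A_{11} & A_{12} \\ A_{21} & A_{22} \end{bmatrix}$ with $A_{11}$ invertible. If $\operatorname{Im} A$ is positive semidefinite, then $\operatorname{Im}\operatorname{PPT}(A)$ is positive semidefinite. (2) Let $A,B\in M_n(\mathbb{C})$ be self-adjoint block $2$ by $2$ matrices (with the same partition) such that for every $t\in[0,1]$ the matrix $(1-t)A_{11}+tB_{11}$ is invertible. If $A\preceq B$, then $\operatorname{PPT}(A)\preceq\operatorname{PPT}(B)$.
   Context: For $A=\begin{bmatrix} A_{11} & A_{12} \\ A_{21} & A_{22} \end{bmatrix}\in M_n(\mathbb{C})$ partitioned into blocks, with $A_{11}$ and $A_{22}$ square (not necessarily of the same size) and $A_{11}$ invertible, the principal pivot transform of $A$ is the matrix (with the same partition) $$\operatorname{PPT}(A)=\begin{bmatrix} -A_{11}^{-1} & A_{11}^{-1}A_{12} \\ A_{21}A_{11}^{-1} & A_{22}-A_{21}A_{11}^{-1}A_{12} \end{bmatrix}.$$ The imaginary part of a square complex matrix $A$ is the self-adjoint matrix $\operatorname{Im}A=\frac{A-A^*}{2i}$, where $A^*$ is the conjugate transpose. For self-adjoint matrices $A,B$ of the same size, $A\preceq B$ means that $B-A$ is positive semidefinite. *)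

theory Defs
  imports "Jordan_Normal_Form.Schur_Decomposition" "Jordan_Normal_Form.Gauss_Jordan_Elimination"
begin

definition self_adjoint :: "complex mat \<Rightarrow> bool" where
  "self_adjoint A \<longleftrightarrow> mat_adjoint A = A"

(* The order on complex numbers is the one of Complex_Order: 0 \<le> z means that z is real and
   nonnegative. The scalar (A *\<^sub>v v) \<bullet>c v is v^* A v. *)
definition pos_semidef :: "complex mat \<Rightarrow> bool" where
  "pos_semidef A \<longleftrightarrow>
     self_adjoint A \<and> (\<forall>v \<in> carrier_vec (dim_row A). 0 \<le> (A *\<^sub>v v) \<bullet>c v)"

definition loewner_le :: "complex mat \<Rightarrow> complex mat \<Rightarrow> bool" (infix "\<preceq>" 50) where
  "A \<preceq> B \<longleftrightarrow>
     dim_row A = dim_row B \<and> dim_col A = dim_col B \<and>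
     self_adjoint A \<and> self_adjoint B \<and> pos_semidef (B - A)"

definition imag_part :: "complex mat \<Rightarrow> complex mat" where
  "imag_part A = (1 / (2 * \<i>)) \<cdot>\<^sub>m (A - mat_adjoint A)"

(* The partition of an n by n matrix is given by the size k \<le> n of its upper left block.
   Only meaningful if that block is invertible: mat_inverse returns None otherwise. *)
definition PPT :: "nat \<Rightarrow> complex mat \<Rightarrow> complex mat" where
  "PPT k A =
     (case split_block A k k of (A11, A12, A21, A22) \<Rightarrow>
        let R = the (mat_inverse A11) in
        four_block_mat (- R) (R * A12) (A21 * R) (A22 - A21 * R * A12))"

end

theory Submission
  imports Defs
begin

text \<open>If \<open>PPT(A) (p, y) = (u, q)\<close>, then \<open>A (u, - y) = (- p, - q)\<close>: up to signs, the transform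
  exchanges the first blocks of input and output. With \<open>x = (u, - y)\<close> for \<open>v = (p, y)\<close> this gives
  \<open>v\<^sup>* Im(PPT(A)) v = x\<^sup>* Im(A) x\<close>, hence (1). For (2), let \<open>A\<^sub>t = (1 - t) A + t B\<close> with
  corresponding vectors \<open>x\<^sub>t\<close>. The same exchange yields
  \<open>v\<^sup>* (PPT(A\<^sub>s) - PPT(A\<^sub>t)) v = (s - t) x\<^sub>t\<^sup>* (B - A) x\<^sub>s\<close>, and \<open>x\<^sub>s\<close> is continuous in \<open>s\<close> by
  Cramer's rule, so \<open>v\<^sup>* PPT(A\<^sub>t) v\<close> has the derivative \<open>x\<^sub>t\<^sup>* (B - A) x\<^sub>t \<ge> 0\<close>.\<close>

section \<open>Sesquilinear forms and adjoints\<close>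

lemma cscalar_prod_append:
  fixes a b c d :: "complex vec"
  assumes "a \<in> carrier_vec n" "b \<in> carrier_vec m" "c \<in> carrier_vec n" "d \<in> carrier_vec m"
  shows "(a @\<^sub>v b) \<bullet>c (c @\<^sub>v d) = a \<bullet>c c + b \<bullet>c d"
proof -
  have "conjugate (c @\<^sub>v d) = conjugate c @\<^sub>v conjugate d"
    by (intro eq_vecI) auto
  then show ?thesis
    using assms by (simp add: scalar_prod_append[of _ n _ m])
qed

lemma cscalar_prod_uminus_left:
  fixes a b :: "complex vec"
  assumes "a \<in> carrier_vec n" "b \<in> carrier_vec n"
  shows "(- a) \<bullet>c b = - (a \<bullet>c b)"
  using assms by simp

lemma cscalar_prod_uminus_right:
  fixes a b :: "complex vec"
  assumes "a \<in> carrier_vec n" "b \<in> carrier_vec n"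
  shows "a \<bullet>c (- b) = - (a \<bullet>c b)"
  using assms by (simp flip: uminus_conjugate_vec)

lemma cnj_cscalar_prod:
  fixes a b :: "complex vec"
  assumes "a \<in> carrier_vec n" "b \<in> carrier_vec n"
  shows "cnj (a \<bullet>c b) = b \<bullet>c a"
  using conjugate_conjugate_sprod[OF assms(2,1)] conjugate_vec_sprod_comm[OF assms] by simp

lemma cscalar_prod_unit_vec:
  fixes v :: "complex vec"
  assumes "v \<in> carrier_vec n" "i < n"
  shows "v \<bullet>c unit_vec n i = v $ i"
proof -
  have "conjugate (unit_vec n i :: complex vec) = unit_vec n i"
    by (intro eq_vecI) (auto simp: unit_vec_def)
  then show ?thesis
    using assms by simp
qed

section \<open>The conjugate transpose and self-adjointness in terms of the form\<close>

lemma dim_mat_adjoint [simp]: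
  "dim_row (mat_adjoint A) = dim_col A" "dim_col (mat_adjoint A) = dim_row A"
  by (simp_all add: mat_adjoint_def)

lemma mat_adjoint_carrier [simp]:
  "A \<in> carrier_mat n m \<Longrightarrow> mat_adjoint A \<in> carrier_mat m n"
  by (auto intro!: carrier_matI)

lemma index_mat_adjoint:
  fixes A :: "complex mat"
  assumes "i < dim_col A" "j < dim_row A"
  shows "mat_adjoint A $$ (i, j) = cnj (A $$ (j, i))"
  using assms by (simp add: mat_adjoint_def mat_of_rows_index)

text \<open>The adjoint is the transpose of the entrywise conjugate \<open>?C\<close>, and
  conjugating \<open>A *\<^sub>v w\<close> gives \<open>?C\<close> applied to the conjugate of
  \<open>w\<close>. The bilinear rule for transposes then applies.\<close>

lemma mat_adjoint_cscalar_prod: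
  fixes A :: "complex mat"
  assumes A: "A \<in> carrier_mat n m" and v: "v \<in> carrier_vec n" and w: "w \<in> carrier_vec m"
  shows "(mat_adjoint A *\<^sub>v v) \<bullet>c w = v \<bullet>c (A *\<^sub>v w)"
proof -
  let ?C = "mat n m (\<lambda>(i, j). cnj (A $$ (i, j)))"
  have "mat_adjoint A = transpose_mat ?C"
    using A by (intro eq_matI) (auto simp: index_mat_adjoint)
  moreover have "conjugate (A *\<^sub>v w) = ?C *\<^sub>v conjugate w"
    using A w by (intro eq_vecI) (auto simp: scalar_prod_def)
  ultimately show ?thesis
    using transpose_vec_mult_scalar[of ?C n m "conjugate w" v] v w by simp
qed

text \<open>The converse tests on unit vectors. This form of self-adjointness suits the transform,
  which is handled below through its action on vectors rather than through its entries.\<close>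

lemma self_adjoint_iff:
  assumes A: "A \<in> carrier_mat n n"
  shows "self_adjoint A \<longleftrightarrow>
    (\<forall>v \<in> carrier_vec n. \<forall>w \<in> carrier_vec n. (A *\<^sub>v v) \<bullet>c w = v \<bullet>c (A *\<^sub>v w))"
proof
  assume "self_adjoint A"
  then show "\<forall>v \<in> carrier_vec n. \<forall>w \<in> carrier_vec n. (A *\<^sub>v v) \<bullet>c w = v \<bullet>c (A *\<^sub>v w)"
    using mat_adjoint_cscalar_prod[OF A] by (simp add: self_adjoint_def)
next
  assume *: "\<forall>v \<in> carrier_vec n. \<forall>w \<in> carrier_vec n. (A *\<^sub>v v) \<bullet>c w = v \<bullet>c (A *\<^sub>v w)"
  have entry: "M $$ (i, j) = (M *\<^sub>v unit_vec n j) \<bullet>c unit_vec n i"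
    if "M \<in> carrier_mat n n" "i < n" "j < n" for M :: "complex mat" and i j
    using that cscalar_prod_unit_vec[of "M *\<^sub>v unit_vec n j" n i] by auto
  show "self_adjoint A"
    unfolding self_adjoint_def
  proof (rule eq_matI)
    fix i j assume "i < dim_row A" "j < dim_col A"
    then have ij: "i < n" "j < n" using A by auto
    have "(mat_adjoint A *\<^sub>v unit_vec n j) \<bullet>c unit_vec n i = (A *\<^sub>v unit_vec n j) \<bullet>c unit_vec n i"
      using * mat_adjoint_cscalar_prod[OF A, of "unit_vec n j" "unit_vec n i"] by simp
    then show "mat_adjoint A $$ (i, j) = A $$ (i, j)"
      using entry[OF A ij] entry[OF mat_adjoint_carrier[OF A] ij] by metis
  qed (use A in auto)
qed

lemma smult_mat_mult_vec:
  fixes A :: "complex mat"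
  assumes "A \<in> carrier_mat n m" "v \<in> carrier_vec m"
  shows "(c \<cdot>\<^sub>m A) *\<^sub>v v = c \<cdot>\<^sub>v (A *\<^sub>v v)"
  using assms by (intro eq_vecI) auto

section \<open>The form of the imaginary part\<close>

lemma imag_part_carrier [simp]: "A \<in> carrier_mat n n \<Longrightarrow> imag_part A \<in> carrier_mat n n"
  by (simp add: imag_part_def minus_carrier_mat)

text \<open>The numerator is the difference that \<open>PPT_cscalar_prod_diff\<close> carries over
  from a matrix to its transform.\<close>

lemma imag_part_cscalar_prod:
  assumes A: "A \<in> carrier_mat n n" and v: "v \<in> carrier_vec n" and w: "w \<in> carrier_vec n"
  shows "(imag_part A *\<^sub>v v) \<bullet>c w = ((A *\<^sub>v v) \<bullet>c w - v \<bullet>c (A *\<^sub>v w)) / (2 * \<i>)"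
proof -
  have "imag_part A *\<^sub>v v = (1 / (2 * \<i>)) \<cdot>\<^sub>v (A *\<^sub>v v - mat_adjoint A *\<^sub>v v)"
    unfolding imag_part_def using A v
    by (subst smult_mat_mult_vec[of _ n n])
      (auto simp: minus_mult_distrib_mat_vec[of _ n n] minus_carrier_mat)
  moreover have "(A *\<^sub>v v - mat_adjoint A *\<^sub>v v) \<bullet>c w = (A *\<^sub>v v) \<bullet>c w - v \<bullet>c (A *\<^sub>v w)"
    using A v w mat_adjoint_cscalar_prod[OF A v w]
    by (subst minus_scalar_prod_distrib[of _ n]) (auto intro!: mult_mat_vec_carrier)
  ultimately show ?thesis
    using A w by simp
qed

lemma self_adjoint_imag_part:
  assumes A: "A \<in> carrier_mat n n"
  shows "self_adjoint (imag_part A)"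
  unfolding self_adjoint_iff[OF imag_part_carrier[OF A]]
proof (intro ballI)
  fix v w :: "complex vec" assume v: "v \<in> carrier_vec n" and w: "w \<in> carrier_vec n"
  have "v \<bullet>c (imag_part A *\<^sub>v w) = cnj ((imag_part A *\<^sub>v w) \<bullet>c v)"
    using cnj_cscalar_prod[OF mult_mat_vec_carrier[OF imag_part_carrier[OF A] w] v] by simp
  \<comment> \<open>Conjugation changes the sign of the numerator (with the roles of
    \<open>v\<close> and \<open>w\<close> exchanged) and also of the denominator
    \<open>2 * \<i>\<close>.\<close>
  also have "\<dots> = (imag_part A *\<^sub>v v) \<bullet>c w"
    using cnj_cscalar_prod[OF mult_mat_vec_carrier[OF A w] v]
      cnj_cscalar_prod[OF w mult_mat_vec_carrier[OF A v]]
    by (simp add: imag_part_cscalar_prod[OF A] v w field_simps)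
  finally show "(imag_part A *\<^sub>v v) \<bullet>c w = v \<bullet>c (imag_part A *\<^sub>v w)" ..
qed

lemma self_adjoint_minus:
  assumes "A \<in> carrier_mat n n" "B \<in> carrier_mat n n" "self_adjoint A" "self_adjoint B"
  shows "self_adjoint (A - B)"
  unfolding self_adjoint_def
proof (rule eq_matI)
  fix i j assume ij: "i < dim_row (A - B)" "j < dim_col (A - B)"
  then have "A $$ (i, j) = cnj (A $$ (j, i))" "B $$ (i, j) = cnj (B $$ (j, i))"
    using assms by (metis carrier_matD index_mat_adjoint index_minus_mat(2,3) self_adjoint_def)+
  then show "mat_adjoint (A - B) $$ (i, j) = (A - B) $$ (i, j)"
    using assms ij by (simp add: index_mat_adjoint)
qed (use assms in auto)

section \<open>The principal pivot transform as an exchange of inputs and outputs\<close>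

text \<open>\<open>PPT\<close> reads its inverse through \<open>the\<close>, so the result
  \<open>None\<close> has to be excluded: it occurs only for non-units of the matrix ring, and
  invertibility makes \<open>A\<close> a unit.\<close>

lemma mat_inverse_invertible:
  fixes A :: "complex mat"
  assumes A: "A \<in> carrier_mat n n" and inv: "invertible_mat A"
  shows "A * the (mat_inverse A) = 1\<^sub>m n" "the (mat_inverse A) * A = 1\<^sub>m n"
    "the (mat_inverse A) \<in> carrier_mat n n"
proof -
  obtain B where B: "A * B = 1\<^sub>m n" "B * A = 1\<^sub>m (dim_row B)"
    using inv A by (auto simp: invertible_mat_def inverts_mat_def)
  \<comment> \<open>The witness comes without dimensions; comparing the column counts in the two
    products fixes them.\<close>
  have "dim_col B = n" "dim_row B = n"
    using B A by (metis carrier_matD(2) index_mult_mat(3) index_one_mat(3))+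
  then have "A \<in> Units (ring_mat TYPE(complex) n ())"
    using A B unfolding Units_def by (auto simp: ring_mat_simps intro!: bexI[of _ B])
  then obtain R where "mat_inverse A = Some R"
    using mat_inverse(1)[OF A] by fastforce
  then show "A * the (mat_inverse A) = 1\<^sub>m n" "the (mat_inverse A) * A = 1\<^sub>m n"
    "the (mat_inverse A) \<in> carrier_mat n n"
    using mat_inverse(2)[OF A] by auto
qed

text \<open>This is the vector x of the introduction. Its first block u solves the first block row
  \<open>A11 u - A12 y = - p\<close>, which is where invertibility of \<open>A11\<close>
  enters.\<close>

definition pivot_vec :: "nat \<Rightarrow> complex mat \<Rightarrow> complex vec \<Rightarrow> complex vec" where
  "pivot_vec k A v =
     (case split_block A k k of (A11, A12, A21, A22) \<Rightarrow>
        let p = vec_first v k; y = vec_last v (dim_vec v - k) in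
        the (mat_inverse A11) *\<^sub>v (A12 *\<^sub>v y - p) @\<^sub>v - y)"

lemma split_block_square:
  assumes "A \<in> carrier_mat n n" "k \<le> n" "split_block A k k = (A11, A12, A21, A22)"
  shows "A11 \<in> carrier_mat k k" "A12 \<in> carrier_mat k (n - k)"
    "A21 \<in> carrier_mat (n - k) k" "A22 \<in> carrier_mat (n - k) (n - k)"
    "A = four_block_mat A11 A12 A21 A22"
  using split_block[OF assms(3), of "n - k" "n - k"] assms(1,2) by auto

lemma PPT_carrier:
  assumes A: "A \<in> carrier_mat n n" and k: "k \<le> n"
    and inv: "invertible_mat (fst (split_block A k k))"
  shows "PPT k A \<in> carrier_mat n n"
proof -
  obtain A11 A12 A21 A22 where s: "split_block A k k = (A11, A12, A21, A22)"
    by (metis prod_cases4)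
  note b = split_block_square[OF A k s]
  have "the (mat_inverse A11) \<in> carrier_mat k k"
    using mat_inverse_invertible[OF b(1)] inv s by simp
  then show ?thesis
    using b(1-4) k four_block_carrier_mat[of "- the (mat_inverse A11)" k k
        "A22 - A21 * the (mat_inverse A11) * A12" "n - k" "n - k"]
    by (simp add: PPT_def s Let_def minus_carrier_mat)
qed

text \<open>The first block row of \<open>A\<close> determines u, and the second one then gives
  \<open>q = A22 y - A21 u\<close>. Eliminating u from q produces the Schur complement in the lower
  right block of the transform.\<close>

lemma PPT_exchange:
  assumes A: "A \<in> carrier_mat n n" and k: "k \<le> n"
    and inv: "invertible_mat (fst (split_block A k k))"
    and p: "p \<in> carrier_vec k" and y: "y \<in> carrier_vec (n - k)"
  obtains u q where "u \<in> carrier_vec k" "q \<in> carrier_vec (n - k)"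
    "pivot_vec k A (p @\<^sub>v y) = u @\<^sub>v - y"
    "A *\<^sub>v (u @\<^sub>v - y) = - p @\<^sub>v - q"
    "PPT k A *\<^sub>v (p @\<^sub>v y) = u @\<^sub>v q"
proof -
  obtain A11 A12 A21 A22 where s: "split_block A k k = (A11, A12, A21, A22)"
    by (metis prod_cases4)
  note b = split_block_square[OF A k s]
  define R where "R = the (mat_inverse A11)"
  have R: "A11 * R = 1\<^sub>m k" "R \<in> carrier_mat k k"
    using mat_inverse_invertible[OF b(1)] inv s by (simp_all add: R_def)
  define u where "u = R *\<^sub>v (A12 *\<^sub>v y - p)"
  define q where "q = A22 *\<^sub>v y - A21 *\<^sub>v u"
  have c: "A12 *\<^sub>v y - p \<in> carrier_vec k" "A12 *\<^sub>v y \<in> carrier_vec k"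
    using b y p by auto
  have u: "u \<in> carrier_vec k"
    using R c by (simp add: u_def)
  have q: "q \<in> carrier_vec (n - k)"
    using b y u by (simp add: q_def)
  have pivot: "pivot_vec k A (p @\<^sub>v y) = u @\<^sub>v - y"
  proof -
    have "vec_first (p @\<^sub>v y) k = p" "vec_last (p @\<^sub>v y) (n - k) = y"
      using p y by (auto intro!: eq_vecI simp: vec_first_def vec_last_def)
    then show ?thesis
      using p y by (simp add: pivot_vec_def s u_def R_def Let_def)
  qed
  have "A *\<^sub>v (u @\<^sub>v - y) = (A11 *\<^sub>v u - A12 *\<^sub>v y) @\<^sub>v (A21 *\<^sub>v u - A22 *\<^sub>v y)"
  proof -
    have "A12 *\<^sub>v (- y) = - (A12 *\<^sub>v y)" "A22 *\<^sub>v (- y) = - (A22 *\<^sub>v y)"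
      using b y by (auto intro!: eq_vecI)
    then show ?thesis
      unfolding b(5) using b u y
      by (subst four_block_mat_mult_vec[OF b(1-4)]) (auto intro!: arg_cong2[of _ _ _ _ append_vec] eq_vecI)
  qed
  also have "A11 *\<^sub>v u = A12 *\<^sub>v y - p"
    using b(1) R c by (simp add: u_def flip: assoc_mult_mat_vec)
  also have "A12 *\<^sub>v y - p - A12 *\<^sub>v y = - p"
    using b p y by (intro eq_vecI) auto
  also have "A21 *\<^sub>v u - A22 *\<^sub>v y = - q"
    using b u y unfolding q_def by (intro eq_vecI) auto
  finally have pre: "A *\<^sub>v (u @\<^sub>v - y) = - p @\<^sub>v - q" .
  have Rp: "u = R *\<^sub>v (A12 *\<^sub>v y) - R *\<^sub>v p"
    using R c p by (simp add: u_def mult_minus_distrib_mat_vec[of _ k k])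
  have top: "- R *\<^sub>v p + R * A12 *\<^sub>v y = u"
    using R b p y c unfolding Rp by (intro eq_vecI) (auto simp: assoc_mult_mat_vec[of _ k k _ "n - k"])
  have "A21 * R *\<^sub>v p + (A22 - A21 * R * A12) *\<^sub>v y
      = A21 *\<^sub>v (R *\<^sub>v p) + (A22 *\<^sub>v y - A21 *\<^sub>v (R *\<^sub>v (A12 *\<^sub>v y)))"
    using R b p y
    by (simp add: minus_mult_distrib_mat_vec[of _ "n - k" "n - k"]
        assoc_mult_mat_vec[of _ "n - k" k _ k] assoc_mult_mat_vec[of _ "n - k" k _ "n - k"])
  \<comment> \<open>Expanding u in the definition of q recovers the lower block row of the
    transform.\<close>
  also have "A21 *\<^sub>v u = A21 *\<^sub>v (R *\<^sub>v (A12 *\<^sub>v y)) - A21 *\<^sub>v (R *\<^sub>v p)"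
    unfolding Rp using R b p c by (simp add: mult_minus_distrib_mat_vec[of _ "n - k" k])
  then have "A21 *\<^sub>v (R *\<^sub>v p) + (A22 *\<^sub>v y - A21 *\<^sub>v (R *\<^sub>v (A12 *\<^sub>v y))) = q"
    unfolding q_def using R b p y c by (intro eq_vecI) auto
  finally have bot: "A21 * R *\<^sub>v p + (A22 - A21 * R * A12) *\<^sub>v y = q" .
  have "PPT k A *\<^sub>v (p @\<^sub>v y) =
      (- R *\<^sub>v p + R * A12 *\<^sub>v y) @\<^sub>v (A21 * R *\<^sub>v p + (A22 - A21 * R * A12) *\<^sub>v y)"
    unfolding PPT_def s Let_def prod.case R_def[symmetric]
    using R b(1-4) p y
    by (intro four_block_mat_mult_vec[of _ k k _ "n - k" _ "n - k"]) (auto simp: minus_carrier_mat)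
  then have "PPT k A *\<^sub>v (p @\<^sub>v y) = u @\<^sub>v q"
    unfolding top bot .
  with u q pivot pre that show thesis by blast
qed

lemma pivot_vec_carrier:
  assumes "A \<in> carrier_mat n n" "k \<le> n" "invertible_mat (fst (split_block A k k))"
    and v: "v \<in> carrier_vec n"
  shows "pivot_vec k A v \<in> carrier_vec n"
proof -
  have "v = vec_first v k @\<^sub>v vec_last v (n - k)"
    using v assms(2) by simp
  then obtain u where "u \<in> carrier_vec k" "pivot_vec k A v = u @\<^sub>v - vec_last v (n - k)"
    using PPT_exchange[OF assms(1-3), of "vec_first v k" "vec_last v (n - k)"]
    by (metis vec_first_carrier vec_last_carrier)
  then show ?thesis
    using assms(2) append_carrier_vec[of u k "- vec_last v (n - k)" "n - k"] by simp
qed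

text \<open>Taking \<open>M = N\<close> handles imaginary parts and self-adjointness, while self-adjoint \<open>M\<close>, \<open>N\<close>
  give the difference quotient.\<close>

lemma PPT_cscalar_prod_diff:
  assumes M: "M \<in> carrier_mat n n" "invertible_mat (fst (split_block M k k))"
    and N: "N \<in> carrier_mat n n" "invertible_mat (fst (split_block N k k))"
    and k: "k \<le> n" and v: "v \<in> carrier_vec n" and w: "w \<in> carrier_vec n"
  shows "(PPT k M *\<^sub>v v) \<bullet>c w - v \<bullet>c (PPT k N *\<^sub>v w) =
    (M *\<^sub>v pivot_vec k M v) \<bullet>c pivot_vec k N w - pivot_vec k M v \<bullet>c (N *\<^sub>v pivot_vec k N w)"
proof -
  define p y p' y' where d: "p = vec_first v k" "y = vec_last v (n - k)"
    "p' = vec_first w k" "y' = vec_last w (n - k)"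
  have c: "p \<in> carrier_vec k" "y \<in> carrier_vec (n - k)"
    "p' \<in> carrier_vec k" "y' \<in> carrier_vec (n - k)"
    by (simp_all add: d)
  have vw: "v = p @\<^sub>v y" "w = p' @\<^sub>v y'"
    using v w k by (simp_all add: d)
  obtain u q where m: "u \<in> carrier_vec k" "q \<in> carrier_vec (n - k)"
    "pivot_vec k M v = u @\<^sub>v - y" "M *\<^sub>v (u @\<^sub>v - y) = - p @\<^sub>v - q"
    "PPT k M *\<^sub>v v = u @\<^sub>v q"
    using PPT_exchange[OF M(1) k M(2) c(1,2)] unfolding vw by metis
  obtain u' q' where m': "u' \<in> carrier_vec k" "q' \<in> carrier_vec (n - k)"
    "pivot_vec k N w = u' @\<^sub>v - y'" "N *\<^sub>v (u' @\<^sub>v - y') = - p' @\<^sub>v - q'"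
    "PPT k N *\<^sub>v w = u' @\<^sub>v q'"
    using PPT_exchange[OF N(1) k N(2) c(3,4)] unfolding vw by metis
  \<comment> \<open>Both sides expand to \<open>u \<bullet>c p' + q \<bullet>c y' - p \<bullet>c u'
    - y \<bullet>c q'\<close>. The signs in the exchange make the mixed terms agree.\<close>
  show ?thesis
    unfolding m(3-5) m'(3-5) unfolding vw using c m(1,2) m'(1,2)
    by (simp add: cscalar_prod_append[of _ k _ "n - k"] cscalar_prod_uminus_left
        cscalar_prod_uminus_right[of _ k] cscalar_prod_uminus_right[of _ "n - k"])
qed

section \<open>Self-adjointness of the transform, and claim (1)\<close>

lemma self_adjoint_PPT:
  assumes A: "A \<in> carrier_mat n n" "invertible_mat (fst (split_block A k k))"
    and k: "k \<le> n" and sa: "self_adjoint A"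
  shows "self_adjoint (PPT k A)"
  unfolding self_adjoint_iff[OF PPT_carrier[OF A(1) k A(2)]]
proof (intro ballI)
  fix v w :: "complex vec" assume v: "v \<in> carrier_vec n" and w: "w \<in> carrier_vec n"
  show "(PPT k A *\<^sub>v v) \<bullet>c w = v \<bullet>c (PPT k A *\<^sub>v w)"
    using PPT_cscalar_prod_diff[OF A A k v w] sa self_adjoint_iff[OF A(1)]
      pivot_vec_carrier[OF A(1) k A(2)] v w by simp
qed

text \<open>The form of the transformed imaginary part at \<open>v\<close> equals the original one
  at \<open>pivot_vec k A v\<close>, so no estimate is involved.\<close>

lemma pos_semidef_imag_part_PPT:
  assumes A: "A \<in> carrier_mat n n" "invertible_mat (fst (split_block A k k))"
    and k: "k \<le> n" and pos: "pos_semidef (imag_part A)"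
  shows "pos_semidef (imag_part (PPT k A))"
proof -
  note P = PPT_carrier[OF A(1) k A(2)]
  have "0 \<le> (imag_part (PPT k A) *\<^sub>v v) \<bullet>c v" if v: "v \<in> carrier_vec n" for v
  proof -
    let ?x = "pivot_vec k A v"
    have x: "?x \<in> carrier_vec n"
      using pivot_vec_carrier[OF A(1) k A(2) v] .
    have "0 \<le> (imag_part A *\<^sub>v ?x) \<bullet>c ?x"
      using pos x imag_part_carrier[OF A(1)] by (auto simp: pos_semidef_def)
    also have "(imag_part A *\<^sub>v ?x) \<bullet>c ?x = (imag_part (PPT k A) *\<^sub>v v) \<bullet>c v"
      unfolding imag_part_cscalar_prod[OF P v v] imag_part_cscalar_prod[OF A(1) x x]
        PPT_cscalar_prod_diff[OF A A k v v] ..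
    finally show ?thesis .
  qed
  then show ?thesis
    using imag_part_carrier[OF P] self_adjoint_imag_part[OF P] by (auto simp: pos_semidef_def)
qed

section \<open>Continuity of the pivot vector\<close>

text \<open>By the Leibniz formula the determinant is a polynomial in the entries.\<close>

lemma continuous_on_det:
  fixes M :: "'a :: topological_space \<Rightarrow> complex mat"
  assumes M: "\<And>s. M s \<in> carrier_mat n n"
    and cont: "\<And>i j. i < n \<Longrightarrow> j < n \<Longrightarrow> continuous_on S (\<lambda>s. M s $$ (i, j))"
  shows "continuous_on S (\<lambda>s. det (M s))"
proof -
  have "continuous_on S (\<lambda>s. \<Sum>p\<in>{p. p permutes {0..<n}}. signof p * (\<Prod>i = 0..<n. M s $$ (i, p i)))"
    by (intro continuous_intros cont) (auto dest: permutes_in_image)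
  then show ?thesis
    using det_def'[OF M] by simp
qed

lemma continuous_on_adj_mat:
  fixes M :: "'a :: topological_space \<Rightarrow> complex mat"
  assumes M: "\<And>s. M s \<in> carrier_mat n n"
    and cont: "\<And>i j. i < n \<Longrightarrow> j < n \<Longrightarrow> continuous_on S (\<lambda>s. M s $$ (i, j))"
    and ij: "i < n" "j < n"
  shows "continuous_on S (\<lambda>s. adj_mat (M s) $$ (i, j))"
proof -
  have dims: "dim_row (M s) = n" "dim_col (M s) = n" for s
    using M[of s] by auto
  \<comment> \<open>The indices are swapped: entry (i, j) of the adjugate is the cofactor that
    deletes row j and column i.\<close>
  have "continuous_on S (\<lambda>s. det (mat_delete (M s) j i))"
    using ij by (intro continuous_on_det[of _ "n - 1"] mat_delete_carrier M)
      (auto simp: mat_delete_def dims intro!: cont)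
  then have "continuous_on S (\<lambda>s. (- 1) ^ (j + i) * det (mat_delete (M s) j i))"
    by (intro continuous_intros)
  then show ?thesis
    using ij by (simp add: adj_mat_def cofactor_def dims)
qed

text \<open>Cramer's rule replaces the output of Gauss-Jordan elimination, which branches on the
  entries, by an expression whose continuity is visible.\<close>

lemma mat_inverse_eq_adj_mat:
  fixes A :: "complex mat"
  assumes A: "A \<in> carrier_mat n n" and inv: "invertible_mat A"
  shows "det A \<noteq> 0" "the (mat_inverse A) = (1 / det A) \<cdot>\<^sub>m adj_mat A"
proof -
  let ?R = "the (mat_inverse A)"
  note R = mat_inverse_invertible[OF A inv]
  show d: "det A \<noteq> 0"
    using det_mult[OF A R(3)] R(1) by auto
  have "adj_mat A = adj_mat A * (A * ?R)"
    using R(1) adj_mat(1)[OF A] by simp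
  also have "\<dots> = (adj_mat A * A) * ?R"
    using assoc_mult_mat[OF adj_mat(1)[OF A] A R(3)] ..
  also have "\<dots> = det A \<cdot>\<^sub>m ?R"
    using R(3) adj_mat(3)[OF A] by (simp add: mult_smult_assoc_mat[of _ n n])
  finally show "?R = (1 / det A) \<cdot>\<^sub>m adj_mat A"
    using d R(3) by (intro eq_matI) auto
qed

lemma continuous_on_mat_inverse:
  fixes M :: "'a :: topological_space \<Rightarrow> complex mat"
  assumes M: "\<And>s. M s \<in> carrier_mat n n" and inv: "\<And>s. s \<in> S \<Longrightarrow> invertible_mat (M s)"
    and cont: "\<And>i j. i < n \<Longrightarrow> j < n \<Longrightarrow> continuous_on S (\<lambda>s. M s $$ (i, j))"
    and ij: "i < n" "j < n"
  shows "continuous_on S (\<lambda>s. the (mat_inverse (M s)) $$ (i, j))"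
proof -
  have "continuous_on S (\<lambda>s. adj_mat (M s) $$ (i, j) / det (M s))"
    using mat_inverse_eq_adj_mat(1)[OF M inv]
    by (intro continuous_intros continuous_on_adj_mat[of _ n] continuous_on_det[of _ n] M cont ij) auto
  moreover have "the (mat_inverse (M s)) $$ (i, j) = adj_mat (M s) $$ (i, j) / det (M s)" if "s \<in> S" for s
    using mat_inverse_eq_adj_mat(2)[OF M inv[OF that]] ij adj_mat(1)[OF M[of s]] by simp
  ultimately show ?thesis
    by (simp cong: continuous_on_cong)
qed

lemma continuous_on_mult_mat_vec:
  fixes M :: "'a :: topological_space \<Rightarrow> complex mat"
  assumes M: "\<And>s. s \<in> S \<Longrightarrow> M s \<in> carrier_mat n m" and z: "\<And>s. s \<in> S \<Longrightarrow> z s \<in> carrier_vec m"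
    and contM: "\<And>i j. i < n \<Longrightarrow> j < m \<Longrightarrow> continuous_on S (\<lambda>s. M s $$ (i, j))"
    and contz: "\<And>j. j < m \<Longrightarrow> continuous_on S (\<lambda>s. z s $ j)"
    and i: "i < n"
  shows "continuous_on S (\<lambda>s. (M s *\<^sub>v z s) $ i)"
proof -
  have "continuous_on S (\<lambda>s. \<Sum>j = 0..<m. M s $$ (i, j) * z s $ j)"
    using i by (intro continuous_intros contM contz) auto
  moreover have "(M s *\<^sub>v z s) $ i = (\<Sum>j = 0..<m. M s $$ (i, j) * z s $ j)" if "s \<in> S" for s
    using M[OF that] z[OF that] i by (simp add: scalar_prod_def)
  ultimately show ?thesis
    by (simp cong: continuous_on_cong)
qed

text \<open>Only the upper blocks of \<open>M s\<close> enter the pivot vector, through an inverse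
  and two matrix-vector products.\<close>

lemma continuous_on_pivot_vec:
  fixes M :: "'a :: topological_space \<Rightarrow> complex mat"
  assumes M: "\<And>s. M s \<in> carrier_mat n n" and k: "k \<le> n"
    and inv: "\<And>s. s \<in> S \<Longrightarrow> invertible_mat (fst (split_block (M s) k k))"
    and cont: "\<And>i j. i < n \<Longrightarrow> j < n \<Longrightarrow> continuous_on S (\<lambda>s. M s $$ (i, j))"
    and v: "v \<in> carrier_vec n" and i: "i < n"
  shows "continuous_on S (\<lambda>s. pivot_vec k (M s) v $ i)"
proof -
  \<comment> \<open>\<open>P s\<close> and \<open>Q s\<close> are the upper left and upper right
    blocks, written by entries; the columns of \<open>Q s\<close> are shifted by
    \<open>k\<close>.\<close>
  define P where "P s = mat k k (\<lambda>ij. M s $$ ij)" for s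
  define Q where "Q s = mat k (n - k) (\<lambda>(i, j). M s $$ (i, j + k))" for s
  define p y where "p = vec_first v k" and "y = vec_last v (n - k)"
  have dims: "dim_row (M s) = n" "dim_col (M s) = n" for s
    using M[of s] by auto
  have py: "p \<in> carrier_vec k" "y \<in> carrier_vec (n - k)"
    by (simp_all add: p_def y_def)
  have PQ: "P s \<in> carrier_mat k k" "Q s \<in> carrier_mat k (n - k)" for s
    by (simp_all add: P_def Q_def)
  have invP: "invertible_mat (P s)" if "s \<in> S" for s
    using inv[OF that] by (simp add: split_block_def Let_def P_def)
  have contP: "continuous_on S (\<lambda>s. P s $$ (i, j))" if "i < k" "j < k" for i j
    using that k cont[of i j] by (simp add: P_def)
  have contQ: "continuous_on S (\<lambda>s. Q s $$ (i, j))" if "i < k" "j < n - k" for i j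
    using that k cont[of i "j + k"] by (simp add: Q_def)
  have pivot: "pivot_vec k (M s) v = the (mat_inverse (P s)) *\<^sub>v (Q s *\<^sub>v y - p) @\<^sub>v - y" for s
    using v dims by (simp add: pivot_vec_def split_block_def Let_def P_def Q_def p_def y_def)
  note R = mat_inverse_invertible(3)[OF PQ(1) invP]
  show ?thesis
  proof (cases "i < k")
    case True
    have "continuous_on S (\<lambda>s. (Q s *\<^sub>v y) $ j)" if "j < k" for j
      using that by (intro continuous_on_mult_mat_vec[of _ _ k "n - k"] PQ py contQ) auto
    then have "continuous_on S (\<lambda>s. (Q s *\<^sub>v y - p) $ j)" if "j < k" for j
      using that py PQ by (simp add: continuous_on_diff)
    moreover have "Q s *\<^sub>v y - p \<in> carrier_vec k" for s
      using py(1) by (rule minus_carrier_vec[OF mult_mat_vec_carrier[OF PQ(2) py(2)]])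
    ultimately have "continuous_on S (\<lambda>s. (the (mat_inverse (P s)) *\<^sub>v (Q s *\<^sub>v y - p)) $ i)"
      using True
      by (intro continuous_on_mult_mat_vec[of _ _ k k] continuous_on_mat_inverse[of _ k] R PQ invP contP)
    moreover have "pivot_vec k (M s) v $ i = (the (mat_inverse (P s)) *\<^sub>v (Q s *\<^sub>v y - p)) $ i"
      if "s \<in> S" for s
      using R[OF that] True py i by (simp add: pivot)
    ultimately show ?thesis
      by (simp cong: continuous_on_cong)
  next
    case False
    \<comment> \<open>The lower block is constant in s.\<close>
    have "pivot_vec k (M s) v $ i = (- y) $ (i - k)" if "s \<in> S" for s
      using R[OF that] False py i by (simp add: pivot)
    then show ?thesis
      by (simp cong: continuous_on_cong)
  qed
qed

section \<open>Monotonicity along a segment\<close>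

text \<open>The difference quotient at t is \<open>g s t\<close>, which tends to
  \<open>g t t\<close> as s tends to t. So f has derivative \<open>g t t \<ge> 0\<close> inside the
  interval.\<close>

lemma nondecreasing_of_difference_quotient:
  fixes f :: "real \<Rightarrow> real" and g :: "real \<Rightarrow> real \<Rightarrow> real"
  assumes "a \<le> b"
    and diff: "\<And>s t. s \<in> {a..b} \<Longrightarrow> t \<in> {a..b} \<Longrightarrow> f s - f t = (s - t) * g s t"
    and cont: "\<And>t. t \<in> {a..b} \<Longrightarrow> continuous_on {a..b} (\<lambda>s. g s t)"
    and nonneg: "\<And>t. t \<in> {a..b} \<Longrightarrow> 0 \<le> g t t"
  shows "f a \<le> f b"
proof (rule DERIV_nonneg_imp_increasing_open[of a b f])
  fix t assume t: "a < t" "t < b"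
  have "continuous (at t within {a..b}) (\<lambda>s. g s t)"
    using cont[of t] t by (simp add: continuous_on_eq_continuous_within)
  then have "isCont (\<lambda>s. g s t) t"
    using t by (simp add: at_within_Icc_at)
  then have "((\<lambda>s. g s t) \<longlongrightarrow> g t t) (at t)"
    by (simp add: isCont_def)
  moreover have "\<forall>\<^sub>F s in at t. g s t = (f s - f t) / (s - t)"
  proof -
    have "g s t = (f s - f t) / (s - t)" if "s \<in> {a<..<b}" "s \<noteq> t" for s
      using diff[of s t] that t by simp
    moreover
    have "\<forall>\<^sub>F s in at t. s \<in> {a<..<b}"
      using t by (intro eventually_at_in_open') auto
    moreover have "\<forall>\<^sub>F s in at t. s \<noteq> t"
      by (simp add: eventually_at_filter)
    ultimately show ?thesis
      by (auto elim: eventually_elim2)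
  qed
  ultimately have "((\<lambda>s. (f s - f t) / (s - t)) \<longlongrightarrow> g t t) (at t)"
    by (rule Lim_transform_eventually)
  then have "DERIV f t :> g t t"
    by (simp add: has_field_derivative_iff)
  then show "\<exists>y. DERIV f t :> y \<and> y \<ge> 0"
    using nonneg[of t] t by auto
next
  \<comment> \<open>Continuity up to the endpoints comes from the same identity, taken at
    \<open>t = a\<close>.\<close>
  have "continuous_on {a..b} (\<lambda>s. f a + (s - a) * g s a)"
    using assms(1) by (intro continuous_intros cont) auto
  moreover have "f a + (s - a) * g s a = f s" if "s \<in> {a..b}" for s
    using diff[OF that, of a] assms(1) by simp
  ultimately show "continuous_on {a..b} f"
    by (rule iffD1[OF continuous_on_cong[OF refl], rotated])
qed fact

text \<open>Invertibility along the whole segment keeps the transform defined and continuous there,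
  so the sign of the derivative can be used from 0 to 1.\<close>

lemma PPT_mono:
  assumes A: "A \<in> carrier_mat n n" and B: "B \<in> carrier_mat n n" and k: "k \<le> n"
    and inv: "\<And>t :: real. 0 \<le> t \<Longrightarrow> t \<le> 1 \<Longrightarrow> invertible_mat
      (complex_of_real (1 - t) \<cdot>\<^sub>m fst (split_block A k k) + complex_of_real t \<cdot>\<^sub>m fst (split_block B k k))"
    and le: "A \<preceq> B"
  shows "PPT k A \<preceq> PPT k B"
proof -
  define M where "M t = complex_of_real (1 - t) \<cdot>\<^sub>m A + complex_of_real t \<cdot>\<^sub>m B" for t :: real
  have saA: "self_adjoint A" and saB: "self_adjoint B" and pos: "pos_semidef (B - A)"
    using le by (auto simp: loewner_le_def)
  have BA: "B - A \<in> carrier_mat n n"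
    using A by (rule minus_carrier_mat)
  have M: "M t \<in> carrier_mat n n" for t
    using A B by (simp add: M_def)
  have M01: "M 0 = A" "M 1 = B"
    using A B by (auto simp: M_def intro!: eq_matI)
  have invM: "invertible_mat (fst (split_block (M t) k k))" if "t \<in> {0..1}" for t
  proof -
    have "fst (split_block (M t) k k) =
        complex_of_real (1 - t) \<cdot>\<^sub>m fst (split_block A k k) + complex_of_real t \<cdot>\<^sub>m fst (split_block B k k)"
      using A B k by (intro eq_matI) (auto simp: split_block_def Let_def M_def)
    then show ?thesis
      using inv[of t] that by simp
  qed
  \<comment> \<open>Written around \<open>A\<close>, the path is affine in t with slope
    \<open>B - A\<close>; hence \<open>M s\<close> and \<open>M t\<close> differ by
    \<open>(s - t)\<close> times \<open>B - A\<close>.\<close>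
  have Mv: "M t *\<^sub>v x = A *\<^sub>v x + complex_of_real t \<cdot>\<^sub>v ((B - A) *\<^sub>v x)" if "x \<in> carrier_vec n" for t x
  proof -
    have "M t *\<^sub>v x = complex_of_real (1 - t) \<cdot>\<^sub>v (A *\<^sub>v x) + complex_of_real t \<cdot>\<^sub>v (B *\<^sub>v x)"
      unfolding M_def using A B that
      by (subst add_mult_distrib_mat_vec[of _ n n]) (auto simp: smult_mat_mult_vec[of _ n n])
    moreover have "(B - A) *\<^sub>v x = B *\<^sub>v x - A *\<^sub>v x"
      using A B that by (simp add: minus_mult_distrib_mat_vec[of _ n n])
    ultimately show ?thesis
      using A B that by (intro eq_vecI) (auto simp: algebra_simps)
  qed
  have form: "(M t *\<^sub>v x) \<bullet>c w = (A *\<^sub>v x) \<bullet>c w + complex_of_real t * (((B - A) *\<^sub>v x) \<bullet>c w)"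
    if "x \<in> carrier_vec n" "w \<in> carrier_vec n" for t x w
    using A BA that mult_mat_vec_carrier[OF A that(1)] mult_mat_vec_carrier[OF BA that(1)]
    unfolding Mv[OF that(1)]
    by (subst add_scalar_prod_distrib[of _ n]) auto
  note saBA = self_adjoint_minus[OF B A saB saA]
  have saM: "self_adjoint (M t)" for t
    unfolding self_adjoint_iff[OF M]
  proof (intro ballI)
    fix x w :: "complex vec" assume x: "x \<in> carrier_vec n" and w: "w \<in> carrier_vec n"
    have "x \<bullet>c (M t *\<^sub>v w) = cnj ((M t *\<^sub>v w) \<bullet>c x)"
      using cnj_cscalar_prod[OF mult_mat_vec_carrier[OF M w] x] by simp
    also have "\<dots> = x \<bullet>c (A *\<^sub>v w) + complex_of_real t * (x \<bullet>c ((B - A) *\<^sub>v w))"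
      unfolding form[OF w x]
      using cnj_cscalar_prod[OF mult_mat_vec_carrier[OF A w] x]
        cnj_cscalar_prod[OF mult_mat_vec_carrier[OF BA w] x] by simp
    also have "\<dots> = (M t *\<^sub>v x) \<bullet>c w"
      using saA saBA x w unfolding form[OF x w] self_adjoint_iff[OF A] self_adjoint_iff[OF BA] by simp
    finally show "(M t *\<^sub>v x) \<bullet>c w = x \<bullet>c (M t *\<^sub>v w)" ..
  qed
  note PM = PPT_carrier[OF M k invM]
  have saP: "self_adjoint (PPT k (M t))" if "t \<in> {0..1}" for t
    using self_adjoint_PPT[OF M invM k saM] that by blast
  have PA: "PPT k A \<in> carrier_mat n n" "self_adjoint (PPT k A)"
    and PB: "PPT k B \<in> carrier_mat n n" "self_adjoint (PPT k B)"
    using PM[of 0] PM[of 1] saP[of 0] saP[of 1] by (simp_all add: M01)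
  have PBA: "PPT k B - PPT k A \<in> carrier_mat n n"
    using PA by (intro minus_carrier_mat)
  note saPBA = self_adjoint_minus[OF PB(1) PA(1) PB(2) PA(2)]
  have "0 \<le> ((PPT k B - PPT k A) *\<^sub>v v) \<bullet>c v" if v: "v \<in> carrier_vec n" for v
  proof -
    define x where "x t = pivot_vec k (M t) v" for t
    have x: "x t \<in> carrier_vec n" if "t \<in> {0..1}" for t
      using pivot_vec_carrier[OF M k invM v] that by (simp add: x_def)
    \<comment> \<open>Real parts are taken to apply real calculus; self-adjointness later shows that
      nothing is lost.\<close>
    define f where "f t = Re ((PPT k (M t) *\<^sub>v v) \<bullet>c v)" for t
    define g where "g s t = Re (((B - A) *\<^sub>v x s) \<bullet>c x t)" for s t
    have "f 0 \<le> f 1"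
    proof (rule nondecreasing_of_difference_quotient[of 0 1 f g])
      fix s t :: real assume st: "s \<in> {0..1}" "t \<in> {0..1}"
      \<comment> \<open>Moving the transform at t to the right argument gives the left-hand side of
        \<open>PPT_cscalar_prod_diff\<close>.\<close>
      have "(PPT k (M s) *\<^sub>v v) \<bullet>c v - (PPT k (M t) *\<^sub>v v) \<bullet>c v =
          (PPT k (M s) *\<^sub>v v) \<bullet>c v - v \<bullet>c (PPT k (M t) *\<^sub>v v)"
        using saP[OF st(2)] v unfolding self_adjoint_iff[OF PM[OF st(2)]] by simp
      also have "\<dots> = (M s *\<^sub>v x s) \<bullet>c x t - x s \<bullet>c (M t *\<^sub>v x t)"
        unfolding x_def by (rule PPT_cscalar_prod_diff[OF M invM[OF st(1)] M invM[OF st(2)] k v v])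
      \<comment> \<open>Now \<open>M s\<close> and \<open>M t\<close> act on the same vector
        \<open>x s\<close>, so their difference can be formed.\<close>
      also have "x s \<bullet>c (M t *\<^sub>v x t) = (M t *\<^sub>v x s) \<bullet>c x t"
        using saM[of t] x st unfolding self_adjoint_iff[OF M] by simp
      also have "(M s *\<^sub>v x s) \<bullet>c x t - (M t *\<^sub>v x s) \<bullet>c x t =
          complex_of_real (s - t) * (((B - A) *\<^sub>v x s) \<bullet>c x t)"
        unfolding form[OF x[OF st(1)] x[OF st(2)]] by (simp add: algebra_simps)
      finally have "Re ((PPT k (M s) *\<^sub>v v) \<bullet>c v - (PPT k (M t) *\<^sub>v v) \<bullet>c v) =
          Re (complex_of_real (s - t) * (((B - A) *\<^sub>v x s) \<bullet>c x t))"
        by (rule arg_cong)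
      then show "f s - f t = (s - t) * g s t"
        unfolding f_def g_def minus_complex.sel Re_complex_of_real
        by (simp del: of_real_diff)
    next
      fix t :: real assume t: "t \<in> {0..1}"
      have "continuous_on {0..1} (\<lambda>s. M s $$ (i, j))" if "i < n" "j < n" for i j
      proof -
        have "M s $$ (i, j) = complex_of_real (1 - s) * A $$ (i, j) + complex_of_real s * B $$ (i, j)" for s
          using A B that by (simp add: M_def)
        then show ?thesis
          by (simp add: continuous_intros)
      qed
      then have contx: "continuous_on {0..1} (\<lambda>s. x s $ i)" if "i < n" for i
        unfolding x_def using that invM v by (intro continuous_on_pivot_vec[OF M k]) auto
      have "continuous_on {0..1} (\<lambda>s. ((B - A) *\<^sub>v x s) $ i)" if "i < n" for i
        using that by (intro continuous_on_mult_mat_vec[of _ _ n n] BA x contx) auto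
      then have "continuous_on {0..1} (\<lambda>s. Re (\<Sum>i = 0..<n. ((B - A) *\<^sub>v x s) $ i * cnj (x t $ i)))"
        by (intro continuous_intros) auto
      moreover have "g s t = Re (\<Sum>i = 0..<n. ((B - A) *\<^sub>v x s) $ i * cnj (x t $ i))" for s
        using x[OF t] by (simp add: g_def scalar_prod_def)
      ultimately show "continuous_on {0..1} (\<lambda>s. g s t)"
        by simp
      show "0 \<le> g t t"
        using pos x[OF t] BA by (auto simp: pos_semidef_def g_def less_eq_complex_def)
    qed simp
    moreover have "((PPT k B - PPT k A) *\<^sub>v v) \<bullet>c v = (PPT k B *\<^sub>v v) \<bullet>c v - (PPT k A *\<^sub>v v) \<bullet>c v"
      using minus_mult_distrib_mat_vec[OF PB(1) PA(1) v]
        minus_scalar_prod_distrib[OF mult_mat_vec_carrier[OF PB(1) v] mult_mat_vec_carrier[OF PA(1) v]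
          carrier_vec_conjugate[OF v]] by simp
    \<comment> \<open>The complex order also demands a vanishing imaginary part, which follows
      because the value equals its own conjugate.\<close>
    moreover have "cnj (((PPT k B - PPT k A) *\<^sub>v v) \<bullet>c v) = ((PPT k B - PPT k A) *\<^sub>v v) \<bullet>c v"
      using cnj_cscalar_prod[OF mult_mat_vec_carrier[OF PBA v] v] saPBA v
      unfolding self_adjoint_iff[OF PBA] by simp
    ultimately show ?thesis
      by (simp add: less_eq_complex_def f_def M01 complex_eq_iff)
  qed
  then show ?thesis
    using PA PB PBA saPBA by (auto simp: loewner_le_def pos_semidef_def)
qed

theorem theorem1p1:
  fixes n k :: nat
  assumes "n \<ge> 1" and "k \<le> n"
  shows "(\<forall>A A11 A12 A21 A22.
            A \<in> carrier_mat n n \<longrightarrow>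
            split_block A k k = (A11, A12, A21, A22) \<longrightarrow>
            invertible_mat A11 \<longrightarrow>
            pos_semidef (imag_part A) \<longrightarrow>
            pos_semidef (imag_part (PPT k A))) \<and>
         (\<forall>A B A11 A12 A21 A22 B11 B12 B21 B22.
            A \<in> carrier_mat n n \<longrightarrow> B \<in> carrier_mat n n \<longrightarrow>
            self_adjoint A \<longrightarrow> self_adjoint B \<longrightarrow>
            split_block A k k = (A11, A12, A21, A22) \<longrightarrow>
            split_block B k k = (B11, B12, B21, B22) \<longrightarrow>
            (\<forall>t::real. 0 \<le> t \<and> t \<le> 1 \<longrightarrow>
               invertible_mat (complex_of_real (1 - t) \<cdot>\<^sub>m A11 + complex_of_real t \<cdot>\<^sub>m B11)) \<longrightarrow>
            A \<preceq> B \<longrightarrow>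
            PPT k A \<preceq> PPT k B)"
proof (intro conjI allI impI)
  fix A A11 A12 A21 A22
  assume "A \<in> carrier_mat n n" "split_block A k k = (A11, A12, A21, A22)" "invertible_mat A11"
    "pos_semidef (imag_part A)"
  then show "pos_semidef (imag_part (PPT k A))"
    using pos_semidef_imag_part_PPT[OF _ _ assms(2)] by simp
next
  fix A B A11 A12 A21 A22 B11 B12 B21 B22
  assume "A \<in> carrier_mat n n" "B \<in> carrier_mat n n"
    "split_block A k k = (A11, A12, A21, A22)" "split_block B k k = (B11, B12, B21, B22)"
    "\<forall>t::real. 0 \<le> t \<and> t \<le> 1 \<longrightarrow>
       invertible_mat (complex_of_real (1 - t) \<cdot>\<^sub>m A11 + complex_of_real t \<cdot>\<^sub>m B11)"
    "A \<preceq> B"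
  then show "PPT k A \<preceq> PPT k B"
    using PPT_mono[OF _ _ assms(2)] by simp
qed

end
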